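(* Let $2<p,q<\infty$ and let $I,J$ be two non-empty sets. Then the pair $(\ell_p(I),\ell_q(J))$ has the $L_{p,p}$ for bilinear mappings.
   Context: All Banach spaces are real, and $S_X$ denotes the unit sphere of $X$. For Banach spaces $X,Y$, the pair $(X,Y)$ has the $L_{p,p}$ for bilinear mappings if, given $\varepsilon>0$ and $(x,y)\in S_X\times S_Y$, there exists $\eta>0$ (depending on $\varepsilon$ and on $(x,y)$) such that whenever a bounded bilinear mapping $B:X\times Y\longrightarrow\mathbb{R}$ with $\|B\|=1$ satisfies $B(x,y)>1-\eta$, there exists another bounded bilinear mapping $G:X\times Y\longrightarrow\mathbb{R}$ with $\|G\|=1$, $G(x,y)=1$ and $\|B-G\|<\varepsilon$. Here $\|B\|=\sup\{|B(u,v)|:\|u\|\leq 1,\|v\|\leq 1\}$. The symbol "$L_{p,p}$" is just the name of the property; its subscripts are unrelated to the exponent $p$ of $\ell_p(I)$. *)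

theory Defs
  imports "HOL-Analysis.Analysis" "HOL-Library.Function_Algebras"
begin

(* Pointwise scalar multiplication; the pointwise additive structure is the one of Function_Algebras. *)
instantiation "fun" :: (type, real_vector) real_vector
begin

definition "scaleR c f = (\<lambda>i. c *\<^sub>R f i)"

instance
  by standard (simp_all add: scaleR_fun_def fun_eq_iff scaleR_add_right scaleR_add_left)

end

(* A type cannot depend on the exponent p, so a real normed space is given here by a linear
   subspace X of a real vector space together with a norm NX on X. Bilinear forms are total
   functions of which only the values on X \<times> Y matter; the definitions below are meant for
   subspaces X, Y and norms NX, NY on them. *)

definition bilinear_form_on ::
    "'a::real_vector set \<Rightarrow> 'b::real_vector set \<Rightarrow> ('a \<Rightarrow> 'b \<Rightarrow> real) \<Rightarrow> bool" where
  "bilinear_form_on X Y B \<longleftrightarrow>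
     (\<forall>u\<in>X. \<forall>u'\<in>X. \<forall>v\<in>Y. B (u + u') v = B u v + B u' v) \<and>
     (\<forall>c. \<forall>u\<in>X. \<forall>v\<in>Y. B (c *\<^sub>R u) v = c * B u v) \<and>
     (\<forall>u\<in>X. \<forall>v\<in>Y. \<forall>v'\<in>Y. B u (v + v') = B u v + B u v') \<and>
     (\<forall>c. \<forall>u\<in>X. \<forall>v\<in>Y. B u (c *\<^sub>R v) = c * B u v)"

definition bounded_bilinear_form_on ::
    "'a::real_vector set \<Rightarrow> ('a \<Rightarrow> real) \<Rightarrow> 'b::real_vector set \<Rightarrow> ('b \<Rightarrow> real) \<Rightarrow>
     ('a \<Rightarrow> 'b \<Rightarrow> real) \<Rightarrow> bool" where
  "bounded_bilinear_form_on X NX Y NY B \<longleftrightarrow>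
     bilinear_form_on X Y B \<and> (\<exists>K. \<forall>u\<in>X. \<forall>v\<in>Y. \<bar>B u v\<bar> \<le> K * NX u * NY v)"

definition bilinear_form_norm ::
    "'a set \<Rightarrow> ('a \<Rightarrow> real) \<Rightarrow> 'b set \<Rightarrow> ('b \<Rightarrow> real) \<Rightarrow> ('a \<Rightarrow> 'b \<Rightarrow> real) \<Rightarrow> real" where
  "bilinear_form_norm X NX Y NY B =
     Sup {\<bar>B u v\<bar> | u v. u \<in> X \<and> v \<in> Y \<and> NX u \<le> 1 \<and> NY v \<le> 1}"

definition Lpp_bilinear ::
    "'a::real_vector set \<Rightarrow> ('a \<Rightarrow> real) \<Rightarrow> 'b::real_vector set \<Rightarrow> ('b \<Rightarrow> real) \<Rightarrow> bool" where
  "Lpp_bilinear X NX Y NY \<longleftrightarrow>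
     (\<forall>\<epsilon>>0. \<forall>x\<in>X. \<forall>y\<in>Y. NX x = 1 \<longrightarrow> NY y = 1 \<longrightarrow>
       (\<exists>\<eta>>0. \<forall>B. bounded_bilinear_form_on X NX Y NY B \<longrightarrow>
          bilinear_form_norm X NX Y NY B = 1 \<longrightarrow> B x y > 1 - \<eta> \<longrightarrow>
          (\<exists>G. bounded_bilinear_form_on X NX Y NY G \<and> bilinear_form_norm X NX Y NY G = 1 \<and>
             G x y = 1 \<and> bilinear_form_norm X NX Y NY (\<lambda>u v. B u v - G u v) < \<epsilon>)))"

(* A family indexed by the set I is represented by its extension by zero to the whole type. *)

definition lp_space :: "real \<Rightarrow> 'i set \<Rightarrow> ('i \<Rightarrow> real) set" where
  "lp_space p I = {x. (\<forall>i. i \<notin> I \<longrightarrow> x i = 0) \<and> (\<lambda>i. \<bar>x i\<bar> powr p) summable_on I}"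

definition lp_norm :: "real \<Rightarrow> 'i set \<Rightarrow> ('i \<Rightarrow> real) \<Rightarrow> real" where
  "lp_norm p I x = (\<Sum>\<^sub>\<infinity>i\<in>I. \<bar>x i\<bar> powr p) powr (1 / p)"

end

theory Submission
  imports Defs
begin

text \<open>If \<open>B\<close> has norm at most one, \<open>B x y\<close> is close to \<open>1\<close>, and \<open>u\<close>, \<open>v\<close> lie in the unit balls with
  \<open>u\<close> vanishing on a large finite set, then
  \<open>2 * B x y + 2 * s * t * B u v = B (x + s u) (y + t v) + B (x - s u) (y - t v)\<close> is at most
  \<open>2 + O(s powr p) + O(t\<^sup>2)\<close>: the exponent \<open>p\<close> comes from the almost disjoint supports of \<open>x\<close> and
  \<open>u\<close>, and the square from the 2-uniform smoothness of \<open>\<ell>\<^sub>q\<close> for \<open>q \<ge> 2\<close>.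
  Taking \<open>t\<close> to be a small multiple of \<open>s\<close>, the assumption \<open>p > 2\<close> makes \<open>B u v\<close> small. By symmetry,
  all forms that almost attain their norm at \<open>(x, y)\<close> are uniformly close to their restriction to one
  finite block of coordinates. Hence a sequence of counterexamples with \<open>B\<^sub>n x y \<longlonglongrightarrow> 1\<close>, which has a
  pointwise cluster point \<open>G\<close> by Tychonoff's theorem, clusters to \<open>G\<close> even in norm, and \<open>G\<close> attains
  its norm at \<open>(x, y)\<close>.\<close>

section \<open>Scalar two-point inequalities\<close>

lemma exp_le_quadratic:
  fixes x :: real
  assumes "\<bar>x\<bar> \<le> 1"
  shows "exp x \<le> 1 + x + x\<^sup>2"
proof (cases "0 \<le> x")
  case True
  then show ?thesis using assms exp_bound by auto
next
  case False
  define y where "y = - x"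
  have y: "0 < y" "y \<le> 1" using False assms by (auto simp: y_def)
  have "1 + y \<le> exp y" by simp
  \<comment> \<open>The bound wanted at \<open>x = - y\<close> is the cofactor of
    \<open>1 + y\<close> in \<open>1 + y ^ 3\<close>, so multiplying it by \<open>exp y\<close>,
    which is at least \<open>1 + y\<close>, gives at least \<open>1\<close>.\<close>
  moreover have "(1 + y) * (1 - y + y\<^sup>2) = 1 + y ^ 3"
    by (simp add: algebra_simps power2_eq_square power3_eq_cube)
  moreover have "0 \<le> 1 - y + y\<^sup>2" using y by simp
  ultimately have "1 \<le> exp y * (1 - y + y\<^sup>2)"
    using y by (smt (verit, best) mult_right_mono zero_less_power)
  then show ?thesis
    by (simp add: y_def exp_minus field_simps)
qed

text \<open>Two regimes. If \<open>a\<close> dominates \<open>q * (t * v)\<close>, a second-order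
  expansion around \<open>a\<close> applies and the linear terms cancel between the two signs.
  Otherwise both summands are of order \<open>(t * v) powr q\<close>, which \<open>t <= 1\<close>
  and \<open>q >= 2\<close> reduce to order \<open>t powr 2 * v powr q\<close>. Each regime
  contributes one half of the constant.\<close>

lemma powr_two_point_pos:
  fixes a v q t :: real
  assumes q: "2 \<le> q" and t: "0 \<le> t" "t \<le> 1" and "0 \<le> a" "0 \<le> v"
  shows "\<bar>a + t * v\<bar> powr q + \<bar>a - t * v\<bar> powr q
    \<le> 2 * a powr q + (2 * q\<^sup>2 + 2 * (q + 1) powr q) * t\<^sup>2 * (a powr q + v powr q)"
proof (cases "q * (t * v) < a")
  case True
  define r where "r = t * v / a"
  have "0 \<le> q * (t * v)" using assms by simp
  with True have a: "a > 0" by linarith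
  have r: "0 \<le> r" "q * r < 1" and tv: "t * v = a * r"
    using True a assms by (simp_all add: r_def divide_less_eq)
  have "1 * r \<le> q * r" using r q by (intro mult_right_mono) auto
  with r have r1: "r < 1" by linarith
  \<comment> \<open>Write the power as \<open>exp (q * ln (1 + z))\<close> and use
    \<open>ln (1 + z) <= z\<close>. The regime \<open>q * r < 1\<close> is exactly what keeps
    \<open>q * z\<close> within the range of the quadratic bound for \<open>exp\<close>.\<close>
  have bnd: "(1 + z) powr q \<le> 1 + q * z + q\<^sup>2 * r\<^sup>2" if "z = r \<or> z = - r" for z
  proof -
    have "(1 + z) powr q = exp (q * ln (1 + z))"
      using that r r1 by (auto simp: powr_def)
    also have "\<dots> \<le> exp (q * z)"
      using that r r1 q by (auto intro!: mult_left_mono ln_add_one_self_le_self2)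
    also have "\<dots> \<le> 1 + q * z + (q * z)\<^sup>2"
      using that r q by (intro exp_le_quadratic) (auto simp: abs_mult)
    finally show ?thesis using that by (auto simp: power_mult_distrib)
  qed
  \<comment> \<open>The left side is \<open>t\<close> squared times the mixed product of
    \<open>a powr (q - 2)\<close> and \<open>v\<close> squared. As \<open>q >= 2\<close>, that
    product is at most the \<open>q\<close>-th power of the larger of \<open>a\<close> and
    \<open>v\<close>.\<close>
  have sq: "a powr q * r\<^sup>2 \<le> t\<^sup>2 * (a powr q + v powr q)"
  proof (cases "v \<le> a")
    case True
    then have "t * (v / a) \<le> t" using a t assms by (intro mult_left_le) auto
    then have "r \<le> t" by (simp add: r_def)
    then have "r\<^sup>2 \<le> t\<^sup>2" using r by (intro power_mono) auto
    then have "a powr q * r\<^sup>2 \<le> a powr q * t\<^sup>2" by (intro mult_left_mono) auto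
    also have "\<dots> \<le> t\<^sup>2 * (a powr q + v powr q)" by (simp add: algebra_simps)
    finally show ?thesis .
  next
    case False
    have "a powr q = a powr (q - 2) * a\<^sup>2"
      using a powr_add[of a "q - 2" 2] by simp
    then have "a powr q * r\<^sup>2 = t\<^sup>2 * (a powr (q - 2) * v powr 2)"
      using a False by (simp add: r_def power_divide power_mult_distrib)
    also have "\<dots> \<le> t\<^sup>2 * (v powr (q - 2) * v powr 2)"
      using a False q by (intro mult_left_mono mult_right_mono powr_mono2) auto
    also have "\<dots> = t\<^sup>2 * v powr q" by (simp only: powr_add [symmetric]) simp
    also have "\<dots> \<le> t\<^sup>2 * (a powr q + v powr q)" by (intro mult_left_mono) auto
    finally show ?thesis .
  qed
  have "\<bar>a + t * v\<bar> powr q + \<bar>a - t * v\<bar> powr q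
    = (a * (1 + r)) powr q + (a * (1 + - r)) powr q"
    using a r r1 by (simp add: tv algebra_simps abs_mult mult_left_le)
  also have "\<dots> = a powr q * ((1 + r) powr q + (1 + - r) powr q)"
    by (simp only: powr_mult distrib_left [of "a powr q"])
  also have "\<dots> \<le> a powr q * (2 + 2 * q\<^sup>2 * r\<^sup>2)"
    using bnd[of r] bnd[of "- r"] by (intro mult_left_mono) auto
  also have "\<dots> = 2 * a powr q + 2 * q\<^sup>2 * (a powr q * r\<^sup>2)"
    by (simp add: algebra_simps)
  also have "\<dots> \<le> 2 * a powr q + 2 * q\<^sup>2 * (t\<^sup>2 * (a powr q + v powr q))"
    using sq by (intro add_left_mono mult_left_mono) auto
  also have "\<dots> \<le> 2 * a powr q + (2 * q\<^sup>2 + 2 * (q + 1) powr q) * (t\<^sup>2 * (a powr q + v powr q))"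
    by (intro add_left_mono mult_right_mono) auto
  finally show ?thesis by (simp add: mult.assoc)
next
  case False
  have tv: "0 \<le> t * v" using assms by simp
  \<comment> \<open>Here \<open>a\<close> is at most \<open>q * (t * v)\<close>, hence the factor
    \<open>q + 1\<close>; then \<open>t powr q <= t powr 2\<close>.\<close>
  have le: "\<bar>z\<bar> powr q \<le> (q + 1) powr q * (t\<^sup>2 * v powr q)" if "\<bar>z\<bar> \<le> a + t * v" for z
  proof -
    have "\<bar>z\<bar> \<le> (q + 1) * (t * v)" using that False by (simp add: algebra_simps)
    then have "\<bar>z\<bar> powr q \<le> ((q + 1) * (t * v)) powr q"
      using q by (intro powr_mono2) auto
    also have "\<dots> = (q + 1) powr q * (t powr q * v powr q)"
      using assms by (simp add: powr_mult)
    also have "\<dots> \<le> (q + 1) powr q * (t powr 2 * v powr q)"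
      using assms by (intro mult_left_mono mult_right_mono powr_mono') auto
    finally show ?thesis using t by simp
  qed
  have "\<bar>a + t * v\<bar> powr q + \<bar>a - t * v\<bar> powr q \<le> 2 * ((q + 1) powr q * (t\<^sup>2 * v powr q))"
    using le[of "a + t * v"] le[of "a - t * v"] assms(4) tv by linarith
  also have "\<dots> = 2 * (q + 1) powr q * t\<^sup>2 * v powr q" by simp
  also have "\<dots> \<le> (2 * q\<^sup>2 + 2 * (q + 1) powr q) * t\<^sup>2 * (a powr q + v powr q)"
    by (intro mult_mono) auto
  finally show ?thesis using powr_ge_zero[of a q] by linarith
qed

text \<open>Replacing \<open>a\<close> and \<open>v\<close> by their absolute values at most
  interchanges the two summands on the left.\<close>

lemma powr_two_point:
  fixes a v q t :: real
  assumes q: "2 \<le> q" and t: "0 \<le> t" "t \<le> 1"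
  shows "\<bar>a + t * v\<bar> powr q + \<bar>a - t * v\<bar> powr q
    \<le> 2 * \<bar>a\<bar> powr q + (2 * q\<^sup>2 + 2 * (q + 1) powr q) * t\<^sup>2 * (\<bar>a\<bar> powr q + \<bar>v\<bar> powr q)"
proof -
  have "\<bar>a + t * v\<bar> powr q + \<bar>a - t * v\<bar> powr q
    = \<bar>\<bar>a\<bar> + t * \<bar>v\<bar>\<bar> powr q + \<bar>\<bar>a\<bar> - t * \<bar>v\<bar>\<bar> powr q"
  proof (cases "(0 \<le> a) = (0 \<le> v)")
    case True
    then have "\<bar>\<bar>a\<bar> + t * \<bar>v\<bar>\<bar> = \<bar>a + t * v\<bar>" "\<bar>\<bar>a\<bar> - t * \<bar>v\<bar>\<bar> = \<bar>a - t * v\<bar>"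
      by (auto simp: abs_if)
    then show ?thesis by simp
  next
    case False
    then have "\<bar>\<bar>a\<bar> + t * \<bar>v\<bar>\<bar> = \<bar>a - t * v\<bar>" "\<bar>\<bar>a\<bar> - t * \<bar>v\<bar>\<bar> = \<bar>a + t * v\<bar>"
      by (auto simp: abs_if)
    then show ?thesis by simp
  qed
  with powr_two_point_pos[OF assms abs_ge_zero abs_ge_zero, of a v] show ?thesis by linarith
qed

lemma powr_add_le:
  fixes a b p :: real
  assumes "0 \<le> p"
  shows "\<bar>a + b\<bar> powr p \<le> 2 powr p * (\<bar>a\<bar> powr p + \<bar>b\<bar> powr p)"
proof -
  have "\<bar>a + b\<bar> powr p \<le> (2 * max \<bar>a\<bar> \<bar>b\<bar>) powr p"
    using assms by (intro powr_mono2) auto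
  also have "\<dots> = 2 powr p * max \<bar>a\<bar> \<bar>b\<bar> powr p" by (simp add: powr_mult)
  also have "\<dots> \<le> 2 powr p * (\<bar>a\<bar> powr p + \<bar>b\<bar> powr p)"
    by (intro mult_left_mono) (auto simp: max_def)
  finally show ?thesis .
qed

section \<open>The sequence spaces and smoothness estimates for their norms\<close>

lemma lp_space_add:
  assumes "0 \<le> p" "x \<in> lp_space p I" "y \<in> lp_space p I"
  shows "x + y \<in> lp_space p I"
proof -
  have "(\<lambda>i. 2 powr p * (\<bar>x i\<bar> powr p + \<bar>y i\<bar> powr p)) summable_on I"
    using assms by (intro summable_on_cmult_right summable_on_add) (auto simp: lp_space_def)
  then have "(\<lambda>i. \<bar>x i + y i\<bar> powr p) summable_on I"
    by (rule summable_on_comparison_test) (use assms powr_add_le in auto)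
  then show ?thesis using assms by (auto simp: lp_space_def)
qed

lemma lp_space_scaleR:
  assumes "x \<in> lp_space p I"
  shows "c *\<^sub>R x \<in> lp_space p I"
  using assms by (auto simp: lp_space_def scaleR_fun_def abs_mult powr_mult
      intro!: summable_on_cmult_right)

lemma lp_norm_nonneg: "0 \<le> lp_norm p I x"
  by (simp add: lp_norm_def)

lemma lp_norm_scaleR:
  assumes "0 < p"
  shows "lp_norm p I (c *\<^sub>R x) = \<bar>c\<bar> * lp_norm p I x"
  using assms by (simp add: lp_norm_def scaleR_fun_def abs_mult powr_mult infsum_cmult_right'
      powr_powr infsum_nonneg)

lemma lp_norm_powr:
  assumes "0 < p"
  shows "(\<Sum>\<^sub>\<infinity>i\<in>I. \<bar>x i\<bar> powr p) = lp_norm p I x powr p"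
  using assms by (simp add: lp_norm_def powr_powr infsum_nonneg)

lemma lp_norm_le_1_iff:
  assumes "0 < p"
  shows "lp_norm p I x \<le> 1 \<longleftrightarrow> (\<Sum>\<^sub>\<infinity>i\<in>I. \<bar>x i\<bar> powr p) \<le> 1"
  using assms lp_norm_nonneg[of p I x] powr_mono2[of p "lp_norm p I x" 1]
    powr_less_mono2[of p 1 "lp_norm p I x"]
  by (auto simp: lp_norm_powr not_le [symmetric])

lemma abs_le_lp_norm:
  assumes "0 < p" "x \<in> lp_space p I" "i \<in> I"
  shows "\<bar>x i\<bar> \<le> lp_norm p I x"
proof -
  have "\<bar>x i\<bar> powr p = (\<Sum>\<^sub>\<infinity>i\<in>{i}. \<bar>x i\<bar> powr p)" by simp
  also have "\<dots> \<le> (\<Sum>\<^sub>\<infinity>i\<in>I. \<bar>x i\<bar> powr p)"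
    using assms by (intro infsum_mono2) (auto simp: lp_space_def)
  finally show ?thesis
    using assms lp_norm_nonneg[of p I x] powr_less_mono2[of p "lp_norm p I x" "\<bar>x i\<bar>"]
    by (force simp: lp_norm_powr)
qed

text \<open>The squared norm is \<open>S powr (2 / p)\<close> for the power sum \<open>S\<close>, a
  concave function of \<open>S\<close> lying below its tangent at \<open>S = 1\<close>. The tangent
  bound is Young's inequality with weights \<open>2 / p\<close> and \<open>1 - 2 / p\<close>. It
  turns estimates of power sums, which can be made coordinatewise, into estimates of squared
  norms.\<close>

lemma lp_norm_square_le:
  assumes "2 \<le> p"
  shows "(lp_norm p I x)\<^sup>2 \<le> 1 + 2 / p * ((\<Sum>\<^sub>\<infinity>i\<in>I. \<bar>x i\<bar> powr p) - 1)"
proof -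
  define S where "S = (\<Sum>\<^sub>\<infinity>i\<in>I. \<bar>x i\<bar> powr p)"
  have S: "0 \<le> S" by (simp add: S_def infsum_nonneg)
  have "(lp_norm p I x)\<^sup>2 = S powr (2 / p)"
    by (simp add: lp_norm_def S_def power2_eq_square powr_add [symmetric])
  also have "\<dots> \<le> 1 + 2 / p * (S - 1)"
  proof (cases "S = 0")
    case False
    then show ?thesis
      using S assms Youngs_inequality_0[of "2 / p" "1 - 2 / p" S 1] by (simp add: right_diff_distrib)
  qed (use assms in simp)
  finally show ?thesis by (simp add: S_def)
qed

text \<open>This is the 2-uniform smoothness estimate: sum the scalar two-point inequality over the
  coordinates, then linearise. The scalar constant doubles because the power sums of
  \<open>y\<close> and \<open>v\<close> are each at most \<open>1\<close>; the factor
  \<open>2 / q\<close> is bounded by \<open>1\<close>.\<close>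

lemma lp_norm_two_point:
  assumes q: "2 \<le> q" and t: "0 \<le> t" "t \<le> 1"
    and y: "y \<in> lp_space q I" "lp_norm q I y \<le> 1" and v: "v \<in> lp_space q I" "lp_norm q I v \<le> 1"
  shows "(lp_norm q I (y + t *\<^sub>R v))\<^sup>2 + (lp_norm q I (y + (- t) *\<^sub>R v))\<^sup>2
    \<le> 2 + (4 * q\<^sup>2 + 4 * (q + 1) powr q) * t\<^sup>2"
proof -
  define C where "C = 2 * q\<^sup>2 + 2 * (q + 1) powr q"
  define S where "S = (\<lambda>x. \<Sum>\<^sub>\<infinity>i\<in>I. \<bar>x i :: real\<bar> powr q)"
  define z w where "z = y + t *\<^sub>R v" and "w = y + (- t) *\<^sub>R v"
  have zw: "z \<in> lp_space q I" "w \<in> lp_space q I"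
    unfolding z_def w_def using q y v by (intro lp_space_add lp_space_scaleR; simp)+
  note sums = zw[unfolded lp_space_def] y(1)[unfolded lp_space_def] v(1)[unfolded lp_space_def]
  have C: "0 \<le> C" by (simp add: C_def)
  have "S z + S w = (\<Sum>\<^sub>\<infinity>i\<in>I. \<bar>z i\<bar> powr q + \<bar>w i\<bar> powr q)"
    unfolding S_def using sums by (intro infsum_add [symmetric]) auto
  also have "\<dots> \<le> (\<Sum>\<^sub>\<infinity>i\<in>I. 2 * \<bar>y i\<bar> powr q + C * t\<^sup>2 * (\<bar>y i\<bar> powr q + \<bar>v i\<bar> powr q))"
    using sums powr_two_point[OF q t]
    by (intro infsum_mono summable_on_add summable_on_cmult_right)
      (auto simp: z_def w_def scaleR_fun_def C_def)
  also have "\<dots> = 2 * S y + C * t\<^sup>2 * (S y + S v)"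
    unfolding S_def using sums
    by (simp add: infsum_add infsum_cmult_right' summable_on_add summable_on_cmult_right)
  also have "\<dots> \<le> 2 * 1 + C * t\<^sup>2 * (1 + 1)"
    using y v q C unfolding S_def
    by (intro add_mono mult_left_mono) (auto simp: lp_norm_le_1_iff)
  finally have sum: "S z + S w - 2 \<le> 2 * C * t\<^sup>2" by simp
  have "(lp_norm q I z)\<^sup>2 + (lp_norm q I w)\<^sup>2 \<le> 2 + 2 / q * (S z + S w - 2)"
    using lp_norm_square_le[OF q, of I z] lp_norm_square_le[OF q, of I w]
    by (simp add: S_def algebra_simps)
  also have "\<dots> \<le> 2 + 2 / q * (2 * C * t\<^sup>2)"
    using sum q by (intro add_left_mono mult_left_mono) auto
  also have "\<dots> \<le> 2 + 1 * (2 * C * t\<^sup>2)"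
    using q C by (intro add_left_mono mult_right_mono) auto
  finally show ?thesis by (simp add: z_def w_def C_def algebra_simps)
qed

lemma lp_tail_small:
  assumes "x \<in> lp_space p I" and "0 < e"
  obtains F where "finite F" "F \<subseteq> I" "(\<Sum>\<^sub>\<infinity>i\<in>I - F. \<bar>x i\<bar> powr p) \<le> e"
proof -
  have s: "(\<lambda>i. \<bar>x i\<bar> powr p) summable_on I" using assms by (auto simp: lp_space_def)
  from infsum_finite_approximation[OF this assms(2)] obtain F
    where F: "finite F" "F \<subseteq> I"
      "dist (\<Sum>i\<in>F. \<bar>x i\<bar> powr p) (\<Sum>\<^sub>\<infinity>i\<in>I. \<bar>x i\<bar> powr p) \<le> e" by blast
  have "(\<Sum>\<^sub>\<infinity>i\<in>I - F. \<bar>x i\<bar> powr p)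
    = (\<Sum>\<^sub>\<infinity>i\<in>I. \<bar>x i\<bar> powr p) - (\<Sum>\<^sub>\<infinity>i\<in>F. \<bar>x i\<bar> powr p)"
    using s F by (intro infsum_Diff) auto
  with F that show ?thesis by (auto simp: dist_real_def)
qed

text \<open>On \<open>F\<close> the perturbed vector coincides with \<open>x\<close> and contributes
  at most \<open>1\<close>. Off \<open>F\<close> both \<open>x\<close> and
  \<open>s *\<^sub>R u\<close> have power sum at most \<open>s powr p\<close>. So the excess over
  \<open>1\<close> is of order \<open>s powr p\<close>, with no term linear in
  \<open>s\<close>.\<close>

lemma lp_norm_tail_perturbation:
  assumes p: "2 \<le> p" and s: "0 \<le> s"
    and x: "x \<in> lp_space p I" "lp_norm p I x \<le> 1" and u: "u \<in> lp_space p I" "lp_norm p I u \<le> 1"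
    and F: "finite F" "F \<subseteq> I" "(\<Sum>\<^sub>\<infinity>i\<in>I - F. \<bar>x i\<bar> powr p) \<le> s powr p" "\<And>i. i \<in> F \<Longrightarrow> u i = 0"
  shows "(lp_norm p I (x + s *\<^sub>R u))\<^sup>2 \<le> 1 + 2 * 2 powr p * s powr p"
proof -
  define z where "z = x + s *\<^sub>R u"
  have z: "z \<in> lp_space p I"
    unfolding z_def using p x u by (auto intro!: lp_space_add lp_space_scaleR)
  have sums: "(\<lambda>i. \<bar>f i\<bar> powr p) summable_on A" if "f \<in> lp_space p I" "A \<subseteq> I" for f A
    using that by (auto simp: lp_space_def intro: summable_on_subset)
  have split: "(\<Sum>\<^sub>\<infinity>i\<in>I. \<bar>f i\<bar> powr p) = (\<Sum>\<^sub>\<infinity>i\<in>F. \<bar>f i\<bar> powr p) + (\<Sum>\<^sub>\<infinity>i\<in>I - F. \<bar>f i\<bar> powr p)"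
    if "f \<in> lp_space p I" for f
    using infsum_Diff[OF sums[OF that] sums[OF that], of I F] F by auto
  have tail: "(\<Sum>\<^sub>\<infinity>i\<in>I - F. \<bar>f i\<bar> powr p) \<le> 1" and head: "(\<Sum>\<^sub>\<infinity>i\<in>F. \<bar>f i\<bar> powr p) \<le> 1"
    if "f \<in> lp_space p I" "lp_norm p I f \<le> 1" for f
    using split[OF that(1)] that(2) p infsum_nonneg[of "I - F" "\<lambda>i. \<bar>f i\<bar> powr p"]
      infsum_nonneg[of F "\<lambda>i. \<bar>f i\<bar> powr p"] by (auto simp: lp_norm_le_1_iff)
  have "(\<Sum>\<^sub>\<infinity>i\<in>F. \<bar>z i\<bar> powr p) = (\<Sum>\<^sub>\<infinity>i\<in>F. \<bar>x i\<bar> powr p)"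
    using F by (intro infsum_cong) (simp add: z_def scaleR_fun_def)
  also have "\<dots> \<le> 1" using head x by blast
  finally have 1: "(\<Sum>\<^sub>\<infinity>i\<in>F. \<bar>z i\<bar> powr p) \<le> 1" .
  have "(\<Sum>\<^sub>\<infinity>i\<in>I - F. \<bar>z i\<bar> powr p)
    \<le> (\<Sum>\<^sub>\<infinity>i\<in>I - F. 2 powr p * (\<bar>x i\<bar> powr p + s powr p * \<bar>u i\<bar> powr p))"
  proof (intro infsum_mono summable_on_add summable_on_cmult_right sums)
    fix i
    show "\<bar>z i\<bar> powr p \<le> 2 powr p * (\<bar>x i\<bar> powr p + s powr p * \<bar>u i\<bar> powr p)"
      using powr_add_le[of p "x i" "s * u i"] p s
      by (simp add: z_def scaleR_fun_def abs_mult powr_mult)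
  qed (use x u z in auto)
  also have "\<dots> = 2 powr p * ((\<Sum>\<^sub>\<infinity>i\<in>I - F. \<bar>x i\<bar> powr p) + s powr p * (\<Sum>\<^sub>\<infinity>i\<in>I - F. \<bar>u i\<bar> powr p))"
    using sums[OF x(1)] sums[OF u(1)]
    by (simp add: infsum_add infsum_cmult_right' summable_on_add summable_on_cmult_right)
  also have "\<dots> \<le> 2 powr p * (s powr p + s powr p * 1)"
    using F tail u by (intro mult_left_mono add_mono) auto
  finally have 2: "(\<Sum>\<^sub>\<infinity>i\<in>I - F. \<bar>z i\<bar> powr p) \<le> 2 * 2 powr p * s powr p" by simp
  have "(lp_norm p I z)\<^sup>2 \<le> 1 + 2 / p * ((\<Sum>\<^sub>\<infinity>i\<in>I. \<bar>z i\<bar> powr p) - 1)"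
    using p by (rule lp_norm_square_le)
  also have "\<dots> \<le> 1 + 2 / p * (2 * 2 powr p * s powr p)"
    using 1 2 split[OF z] p by (intro add_left_mono mult_left_mono) auto
  also have "\<dots> \<le> 1 + 1 * (2 * 2 powr p * s powr p)"
    using p by (intro add_left_mono mult_right_mono) auto
  finally show ?thesis by (simp add: z_def)
qed

section \<open>Uniform smallness of almost norm-attaining forms on tails\<close>

lemma bilinear_form_on_swap:
  "bilinear_form_on X Y B \<Longrightarrow> bilinear_form_on Y X (\<lambda>v u. B u v)"
  by (simp add: bilinear_form_on_def)

text \<open>The set \<open>F\<close> and the threshold \<open>\<eta>\<close> are chosen before
  \<open>B\<close>, so the bound holds simultaneously for all forms that almost attain their bound
  at \<open>(x, y)\<close>. This uniformity is what later upgrades pointwise convergence to norm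
  convergence.\<close>

lemma bilinear_tail_small:
  fixes p q d :: real and x :: "'i \<Rightarrow> real" and y :: "'j \<Rightarrow> real"
  assumes p: "2 < p" and q: "2 \<le> q" and d: "0 < d"
    and x: "x \<in> lp_space p I" "lp_norm p I x \<le> 1" and y: "y \<in> lp_space q J" "lp_norm q J y \<le> 1"
  shows "\<exists>F \<eta>. finite F \<and> F \<subseteq> I \<and> 0 < \<eta> \<and>
    (\<forall>B u v. bilinear_form_on (lp_space p I) (lp_space q J) B \<longrightarrow>
      (\<forall>u\<in>lp_space p I. \<forall>v\<in>lp_space q J. \<bar>B u v\<bar> \<le> lp_norm p I u * lp_norm q J v) \<longrightarrow>
      1 - \<eta> < B x y \<longrightarrow> u \<in> lp_space p I \<longrightarrow> lp_norm p I u \<le> 1 \<longrightarrow> (\<forall>i\<in>F. u i = 0) \<longrightarrow>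
      v \<in> lp_space q J \<longrightarrow> lp_norm q J v \<le> 1 \<longrightarrow> \<bar>B u v\<bar> \<le> d)"
proof -
  define K where "K = 2 * 2 powr p"
  define C where "C = 4 * q\<^sup>2 + 4 * (q + 1) powr q"
  have K: "K > 0" and C: "C > 0" using q by (auto simp: K_def C_def intro: add_pos_nonneg)
  \<comment> \<open>\<open>\<theta>\<close> is the ratio \<open>t / s\<close>: with
    \<open>C * \<theta> <= d\<close>, the error \<open>C\<close> times \<open>t\<close> squared is
    at most \<open>s * t * d\<close>.\<close>
  define \<theta> where "\<theta> = min 1 (d / C)"
  have \<theta>: "0 < \<theta>" "\<theta> \<le> 1" "C * \<theta> \<le> d"
    using C d by (auto simp: \<theta>_def min_def field_simps)
  \<comment> \<open>Solves \<open>K * s powr p <= s * t * d\<close> with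
    \<open>t = \<theta> * s\<close>, that is, \<open>K * s powr (p - 2) <= \<theta> * d\<close>.
    This is possible because \<open>p - 2\<close> is positive.\<close>
  define s where "s = min 1 ((\<theta> * d / K) powr (1 / (p - 2)))"
  have s: "0 < s" "s \<le> 1" using \<theta> d K by (auto simp: s_def)
  have "s powr (p - 2) \<le> ((\<theta> * d / K) powr (1 / (p - 2))) powr (p - 2)"
    using p s by (intro powr_mono2) (auto simp: s_def)
  also have "\<dots> = \<theta> * d / K"
    using p \<theta> d K by (simp add: powr_powr)
  finally have "K * s powr (p - 2) \<le> \<theta> * d" using K by (simp add: field_simps)
  then have "K * s powr (p - 2) * s\<^sup>2 \<le> \<theta> * d * s\<^sup>2" by (intro mult_right_mono) auto
  moreover have "s powr p = s powr (p - 2) * s\<^sup>2"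
    using s powr_add[of s "p - 2" 2] by simp
  ultimately have Ks: "K * s powr p \<le> \<theta> * s\<^sup>2 * d" by (simp add: mult_ac)
  define t where "t = \<theta> * s"
  have t: "0 < t" "t \<le> 1" using \<theta> s by (auto simp: t_def mult_le_one)
  \<comment> \<open>In units of \<open>s * t * d\<close>, the three errors
    \<open>2 * \<eta>\<close>, \<open>K * s powr p\<close> and half of \<open>C\<close> times
    \<open>t\<close> squared are at most 1/2, 1 and 1/2. They add up to the coefficient 2 in front
    of \<open>s * t * B u v\<close>.\<close>
  define \<eta> where "\<eta> = \<theta> * s\<^sup>2 * d / 4"
  have \<eta>: "\<eta> > 0" using \<theta> s d by (simp add: \<eta>_def)
  have "0 < s powr p" using s by simp
  then obtain F where F: "finite F" "F \<subseteq> I" "(\<Sum>\<^sub>\<infinity>i\<in>I - F. \<bar>x i\<bar> powr p) \<le> s powr p"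
    using lp_tail_small[OF x(1)] by blast
  have le: "B u v \<le> d"
    if B: "bilinear_form_on (lp_space p I) (lp_space q J) B"
      and bd: "\<forall>u\<in>lp_space p I. \<forall>v\<in>lp_space q J. \<bar>B u v\<bar> \<le> lp_norm p I u * lp_norm q J v"
      and Bxy: "1 - \<eta> < B x y"
      and u: "u \<in> lp_space p I" "lp_norm p I u \<le> 1" "\<forall>i\<in>F. u i = 0"
      and v: "v \<in> lp_space q J" "lp_norm q J v \<le> 1" for B u v
  proof -
    \<comment> \<open>Separating the norm product into squares is essential: in the second space
      only the sum of the two squared norms is controlled, not each one.\<close>
    have amgm: "B a b \<le> ((lp_norm p I a)\<^sup>2 + (lp_norm q J b)\<^sup>2) / 2"
      if "a \<in> lp_space p I" "b \<in> lp_space q J" for a b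
    proof -
      have "B a b \<le> lp_norm p I a * lp_norm q J b"
        using bd that by (meson abs_le_D1)
      also have "\<dots> \<le> ((lp_norm p I a)\<^sup>2 + (lp_norm q J b)\<^sup>2) / 2"
        using sum_squares_bound[of "lp_norm p I a" "lp_norm q J b"] by simp
      finally show ?thesis .
    qed
    have X: "x + c *\<^sub>R u \<in> lp_space p I" for c
      using p x u by (intro lp_space_add lp_space_scaleR) auto
    have Y: "y + c *\<^sub>R v \<in> lp_space q J" for c
      using q y v by (intro lp_space_add lp_space_scaleR) auto
    \<comment> \<open>The two mixed terms are odd in \<open>a\<close> and in \<open>b\<close>, so
      they cancel when the expansions at \<open>(s, t)\<close> and \<open>(- s, - t)\<close> are
      added.\<close>
    have expand: "B (x + a *\<^sub>R u) (y + b *\<^sub>R v) = B x y + b * B x v + a * B u y + a * b * B u v" for a b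
    proof -
      have "b *\<^sub>R v \<in> lp_space q J" "a *\<^sub>R u \<in> lp_space p I"
        using u v by (auto intro: lp_space_scaleR)
      with B x y u v Y[of b] show ?thesis
        unfolding bilinear_form_on_def by (simp add: algebra_simps)
    qed
    have u': "- u \<in> lp_space p I" "lp_norm p I (- u) \<le> 1" "\<forall>i\<in>F. (- u) i = 0"
      using u by (auto simp: lp_space_def lp_norm_def)
    have "(lp_norm p I (x + s *\<^sub>R u))\<^sup>2 \<le> 1 + K * s powr p"
      unfolding K_def using p s x u F by (intro lp_norm_tail_perturbation) auto
    moreover have "(lp_norm p I (x + (- s) *\<^sub>R u))\<^sup>2 \<le> 1 + K * s powr p"
      unfolding K_def using lp_norm_tail_perturbation[of p s x I "- u" F] p s x u' F by auto
    moreover have "(lp_norm q J (y + t *\<^sub>R v))\<^sup>2 + (lp_norm q J (y + (- t) *\<^sub>R v))\<^sup>2 \<le> 2 + C * t\<^sup>2"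
      unfolding C_def using q t y v by (intro lp_norm_two_point) auto
    moreover have "B (x + s *\<^sub>R u) (y + t *\<^sub>R v) + B (x + (- s) *\<^sub>R u) (y + (- t) *\<^sub>R v)
      = 2 * B x y + 2 * (s * t * B u v)"
      unfolding expand by simp
    ultimately have "2 * B x y + 2 * (s * t * B u v) \<le> 2 + K * s powr p + C * t\<^sup>2 / 2"
      using amgm[OF X[of s] Y[of t]] amgm[OF X[of "- s"] Y[of "- t"]] by argo
    with Bxy have "2 * (s * t * B u v) \<le> 2 * \<eta> + K * s powr p + C * t\<^sup>2 / 2" by linarith
    moreover have "C * t\<^sup>2 \<le> \<theta> * s\<^sup>2 * d"
    proof -
      have "C * t\<^sup>2 = (\<theta> * s\<^sup>2) * (C * \<theta>)" by (simp add: t_def power2_eq_square)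
      also have "\<dots> \<le> (\<theta> * s\<^sup>2) * d" using \<theta> by (intro mult_left_mono) auto
      finally show ?thesis .
    qed
    ultimately have "(\<theta> * s\<^sup>2) * B u v \<le> (\<theta> * s\<^sup>2) * d"
      using Ks by (simp add: \<eta>_def t_def power2_eq_square mult_ac)
    then show ?thesis using \<theta> s by simp
  qed
  have "\<bar>B u v\<bar> \<le> d"
    if B: "bilinear_form_on (lp_space p I) (lp_space q J) B"
      and bd: "\<forall>u\<in>lp_space p I. \<forall>v\<in>lp_space q J. \<bar>B u v\<bar> \<le> lp_norm p I u * lp_norm q J v"
      and Bxy: "1 - \<eta> < B x y"
      and u: "u \<in> lp_space p I" "lp_norm p I u \<le> 1" "\<forall>i\<in>F. u i = 0"
      and v: "v \<in> lp_space q J" "lp_norm q J v \<le> 1" for B u v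
  proof -
    have u': "(- 1) *\<^sub>R u \<in> lp_space p I" "lp_norm p I ((- 1) *\<^sub>R u) \<le> 1" "\<forall>i\<in>F. ((- 1) *\<^sub>R u) i = 0"
      using u p lp_space_scaleR[of u p I "- 1"] lp_norm_scaleR[of p I "- 1" u] by auto
    have "B ((- 1) *\<^sub>R u) v = (- 1) * B u v"
      using B u v unfolding bilinear_form_on_def by blast
    then show ?thesis
      using le[OF B bd Bxy u v] le[OF B bd Bxy u' v] by linarith
  qed
  with F \<eta> show ?thesis by blast
qed

section \<open>The norm of a bilinear form and pointwise cluster points\<close>

lemma bilinear_form_norm_le:
  assumes "NX 0 \<le> 1" "0 \<in> X" "NY 0 \<le> 1" "0 \<in> Y"
    and "\<And>u v. u \<in> X \<Longrightarrow> v \<in> Y \<Longrightarrow> NX u \<le> 1 \<Longrightarrow> NY v \<le> 1 \<Longrightarrow> \<bar>B u v\<bar> \<le> c"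
  shows "bilinear_form_norm X NX Y NY B \<le> c"
  unfolding bilinear_form_norm_def using assms by (intro cSup_least) auto

lemma bilinear_form_norm_upper:
  assumes "\<And>u v. u \<in> X \<Longrightarrow> v \<in> Y \<Longrightarrow> NX u \<le> 1 \<Longrightarrow> NY v \<le> 1 \<Longrightarrow> \<bar>B u v\<bar> \<le> c"
    and "u \<in> X" "v \<in> Y" "NX u \<le> 1" "NY v \<le> 1"
  shows "\<bar>B u v\<bar> \<le> bilinear_form_norm X NX Y NY B"
  unfolding bilinear_form_norm_def using assms by (intro cSup_upper bdd_aboveI[of _ c]) auto

lemma abs_bilinear_le_norm:
  assumes B: "bounded_bilinear_form_on X NX Y NY B"
    and X: "\<And>c u. u \<in> X \<Longrightarrow> c *\<^sub>R u \<in> X" "\<And>c u. NX (c *\<^sub>R u) = \<bar>c\<bar> * NX u" "\<And>u. 0 \<le> NX u"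
    and Y: "\<And>c v. v \<in> Y \<Longrightarrow> c *\<^sub>R v \<in> Y" "\<And>c v. NY (c *\<^sub>R v) = \<bar>c\<bar> * NY v" "\<And>v. 0 \<le> NY v"
    and uv: "u \<in> X" "v \<in> Y"
  shows "\<bar>B u v\<bar> \<le> bilinear_form_norm X NX Y NY B * NX u * NY v"
proof -
  obtain K where K: "\<And>u v. u \<in> X \<Longrightarrow> v \<in> Y \<Longrightarrow> \<bar>B u v\<bar> \<le> K * NX u * NY v"
    and bil: "bilinear_form_on X Y B"
    using B unfolding bounded_bilinear_form_on_def by blast
  have bounded: "\<bar>B a b\<bar> \<le> \<bar>K\<bar>" if "a \<in> X" "b \<in> Y" "NX a \<le> 1" "NY b \<le> 1" for a b
  proof -
    have "\<bar>B a b\<bar> \<le> K * (NX a * NY b)" using K[OF that(1,2)] by (simp add: mult.assoc)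
    also have "\<dots> \<le> \<bar>K\<bar> * (NX a * NY b)" using X Y by (intro mult_right_mono) auto
    also have "\<dots> \<le> \<bar>K\<bar> * 1" using that X Y by (intro mult_left_mono mult_le_one) auto
    finally show ?thesis by simp
  qed
  show ?thesis
  proof (cases "NX u = 0 \<or> NY v = 0")
    \<comment> \<open>Normalisation is impossible here, but the boundedness constant
      \<open>K\<close> already forces \<open>B u v = 0\<close>.\<close>
    case True
    then show ?thesis using K[OF uv] by auto
  next
    case False
    then have pos: "NX u > 0" "NY v > 0" using X(3)[of u] Y(3)[of v] by auto
    define a b where "a = (1 / NX u) *\<^sub>R u" and "b = (1 / NY v) *\<^sub>R v"
    have ab: "a \<in> X" "b \<in> Y" "NX a \<le> 1" "NY b \<le> 1"
      unfolding a_def b_def using uv X Y pos by auto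
    have "B a b = (1 / NX u) * (1 / NY v) * B u v"
      using bil uv X(1) Y(1) unfolding bilinear_form_on_def a_def b_def by simp
    then have "B u v = B a b * (NX u * NY v)" using pos by simp
    then have "\<bar>B u v\<bar> = \<bar>B a b\<bar> * (NX u * NY v)" using pos by (simp add: abs_mult)
    also have "\<dots> \<le> bilinear_form_norm X NX Y NY B * (NX u * NY v)"
      using pos by (intro mult_right_mono bilinear_form_norm_upper[OF bounded] ab) auto
    finally show ?thesis by (simp add: mult.assoc)
  qed
qed

text \<open>The index sets may be uncountable, so a diagonal subsequence need not exist; compactness
  of a product of intervals yields a filter instead. Since it is finer than
  \<open>sequentially\<close>, ordinary limits persist along it.\<close>

lemma pointwise_cluster_filter:
  fixes B :: "nat \<Rightarrow> 'a \<Rightarrow> 'b \<Rightarrow> real"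
  assumes "\<And>n a b. a \<in> X \<Longrightarrow> b \<in> Y \<Longrightarrow> \<bar>B n a b\<bar> \<le> K a b"
  obtains F G where "F \<le> sequentially" "F \<noteq> bot"
    "\<And>a b. a \<in> X \<Longrightarrow> b \<in> Y \<Longrightarrow> ((\<lambda>n. B n a b) \<longlongrightarrow> G a b) F"
proof -
  \<comment> \<open>Extension by zero puts every \<open>f n\<close> into one full product; the
    absolute value of \<open>K\<close> keeps \<open>0\<close> inside each interval.\<close>
  define f where "f n = (\<lambda>(a, b). if a \<in> X \<and> b \<in> Y then B n a b else 0)" for n
  define U where "U = (\<Pi>\<^sub>E z\<in>UNIV. {- \<bar>K (fst z) (snd z)\<bar> .. \<bar>K (fst z) (snd z)\<bar>})"
  have "\<bar>f n (a, b)\<bar> \<le> \<bar>K a b\<bar>" for n a b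
    using assms[of a b n] by (auto simp: f_def)
  then have fU: "f n \<in> U" for n by (auto simp: U_def abs_le_iff minus_le_iff)
  have "compactin (product_topology (\<lambda>_. euclidean) UNIV) U"
    unfolding U_def by (subst compactin_PiE) auto
  then have "compact U" by (metis compactin_euclidean_iff euclidean_product_topology)
  moreover have "filtermap f sequentially \<noteq> bot" by (simp add: filtermap_bot_iff)
  moreover have "eventually (\<lambda>g. g \<in> U) (filtermap f sequentially)"
    using fU by (simp add: eventually_filtermap)
  ultimately obtain g where g: "inf (nhds g) (filtermap f sequentially) \<noteq> bot"
    unfolding compact_filter by blast
  \<comment> \<open>Neighbourhoods of the cluster point are pulled back to the indices; that
    \<open>g\<close> is a cluster point is what makes the result nontrivial.\<close>
  define F where "F = inf (filtercomap f (nhds g)) sequentially"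
  have nb: "F \<noteq> bot"
  proof
    assume "F = bot"
    then obtain P Q where P: "eventually P (nhds g)" and Q: "eventually Q sequentially"
      and PQ: "\<And>n. P (f n) \<Longrightarrow> Q n \<Longrightarrow> False"
      unfolding F_def trivial_limit_def eventually_inf eventually_filtercomap by metis
    have "eventually (\<lambda>h. \<not> P h) (filtermap f sequentially)"
      unfolding eventually_filtermap using Q by (rule eventually_mono) (use PQ in blast)
    with P have "eventually (\<lambda>_. False) (inf (nhds g) (filtermap f sequentially))"
      unfolding eventually_inf by blast
    with g show False by (simp add: trivial_limit_def)
  qed
  have lim: "filterlim f (nhds g) F"
    unfolding F_def by (intro filterlim_mono[OF filterlim_filtercomap order_refl inf_le1])
  have coord: "((\<lambda>n. f n (a, b)) \<longlongrightarrow> g (a, b)) F" for a b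
  proof (rule topological_tendstoI)
    fix S :: "real set"
    assume S: "open S" "g (a, b) \<in> S"
    have "open ((\<lambda>h. h (a, b)) -` S)"
      by (intro open_vimage S continuous_on_product_coordinates)
    from topological_tendstoD[OF lim this] S
    show "\<forall>\<^sub>F n in F. f n (a, b) \<in> S" by simp
  qed
  have "((\<lambda>n. B n a b) \<longlongrightarrow> g (a, b)) F" if "a \<in> X" "b \<in> Y" for a b
    using coord[of a b] that by (simp add: f_def)
  moreover have "F \<le> sequentially" by (simp add: F_def)
  ultimately show ?thesis using that[of F "\<lambda>a b. g (a, b)"] nb by simp
qed

section \<open>Truncations and finite coordinate blocks\<close>

lemma lp_dominated:
  assumes "0 < p" "u \<in> lp_space p I" "\<And>i. \<bar>w i\<bar> \<le> \<bar>u i\<bar>"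
  shows "w \<in> lp_space p I" "lp_norm p I w \<le> lp_norm p I u"
proof -
  have le: "\<bar>w i\<bar> powr p \<le> \<bar>u i\<bar> powr p" for i
    using assms by (intro powr_mono2) auto
  have u: "(\<lambda>i. \<bar>u i\<bar> powr p) summable_on I" using assms by (simp add: lp_space_def)
  then have w: "(\<lambda>i. \<bar>w i\<bar> powr p) summable_on I"
    by (rule summable_on_comparison_test) (use le in auto)
  have "w i = 0" if "i \<notin> I" for i
    using assms(2) assms(3)[of i] that by (simp add: lp_space_def)
  with w show "w \<in> lp_space p I" by (simp add: lp_space_def)
  show "lp_norm p I w \<le> lp_norm p I u"
    unfolding lp_norm_def using assms(1)
    by (intro powr_mono2 infsum_mono u w le) (auto simp: infsum_nonneg)
qed

lemma lp_space_finite_support: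
  assumes "0 < p" "finite S" "S \<subseteq> I"
  shows "(\<lambda>i. if i \<in> S then u i else 0) \<in> lp_space p I"
proof -
  have "(\<lambda>i. \<bar>if i \<in> S then u i else 0\<bar> powr p) summable_on S"
    using assms by simp
  then have "(\<lambda>i. \<bar>if i \<in> S then u i else 0\<bar> powr p) summable_on I"
    by (rule summable_on_cong_neutral[THEN iffD1, rotated -1]) (use assms in auto)
  then show ?thesis using assms by (auto simp: lp_space_def)
qed

lemma lp_space_indicator_singleton:
  assumes "0 < p" "i \<in> I"
  shows "indicator {i} \<in> lp_space p I"
proof -
  have "(indicator {i} :: 'a \<Rightarrow> real) = (\<lambda>k. if k \<in> {i} then 1 else 0)"
    by (auto simp: fun_eq_iff indicator_def)
  with lp_space_finite_support[of p "{i}" I "\<lambda>_. 1"] assms show ?thesis by simp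
qed

lemma linear_finite_support_expand:
  fixes f :: "('i \<Rightarrow> real) \<Rightarrow> real"
  assumes p: "0 < p" and S: "finite S" "S \<subseteq> I"
    and add: "\<And>u w. u \<in> lp_space p I \<Longrightarrow> w \<in> lp_space p I \<Longrightarrow> f (u + w) = f u + f w"
    and scale: "\<And>c u. u \<in> lp_space p I \<Longrightarrow> f (c *\<^sub>R u) = c * f u"
  shows "f (\<lambda>i. if i \<in> S then u i else 0) = (\<Sum>i\<in>S. u i * f (indicator {i}))"
  using S
proof (induction S rule: finite_induct)
  case empty
  have "(\<lambda>i. 0) \<in> lp_space p I" by (simp add: lp_space_def)
  from scale[OF this, of 0] show ?case by (simp add: scaleR_fun_def)
next
  case (insert k S)
  have ind: "indicator {k} \<in> lp_space p I"
    using insert p by (intro lp_space_indicator_singleton) auto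
  have "(\<lambda>i. if i \<in> insert k S then u i else 0)
    = u k *\<^sub>R indicator {k} + (\<lambda>i. if i \<in> S then u i else 0)"
    using insert by (auto simp: fun_eq_iff scaleR_fun_def indicator_def)
  then show ?case
    using insert p ind
    by (simp add: add scale lp_space_scaleR lp_space_finite_support)
qed

text \<open>On a finite block the form is bounded, uniformly over the unit balls, by finitely many
  matrix entries. Pointwise convergence at pairs of unit vectors therefore suffices there.\<close>

lemma bilinear_block_le:
  assumes p: "0 < p" "0 < q" and S: "finite S" "S \<subseteq> I" and T: "finite T" "T \<subseteq> J"
    and D: "bilinear_form_on (lp_space p I) (lp_space q J) D"
    and u: "\<And>i. i \<in> S \<Longrightarrow> \<bar>u i\<bar> \<le> 1" and v: "\<And>j. j \<in> T \<Longrightarrow> \<bar>v j\<bar> \<le> 1"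
  shows "\<bar>D (\<lambda>i. if i \<in> S then u i else 0) (\<lambda>j. if j \<in> T then v j else 0)\<bar>
    \<le> (\<Sum>i\<in>S. \<Sum>j\<in>T. \<bar>D (indicator {i}) (indicator {j})\<bar>)"
proof -
  let ?v = "\<lambda>j. if j \<in> T then v j else 0"
  have ind: "indicator {i} \<in> lp_space p I" if "i \<in> S" for i
    using that S p by (intro lp_space_indicator_singleton) auto
  have v': "?v \<in> lp_space q J" using p T by (intro lp_space_finite_support)
  have "D (\<lambda>i. if i \<in> S then u i else 0) ?v = (\<Sum>i\<in>S. u i * D (indicator {i}) ?v)"
    using D v' p S unfolding bilinear_form_on_def
    by (intro linear_finite_support_expand[where f = "\<lambda>u. D u ?v" and p = p and I = I]) auto
  also have "\<dots> = (\<Sum>i\<in>S. u i * (\<Sum>j\<in>T. v j * D (indicator {i}) (indicator {j})))"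
    using D ind p T unfolding bilinear_form_on_def
    by (intro sum.cong refl arg_cong2[where f = "(*)"]
        linear_finite_support_expand[where p = q and I = J]) blast+
  also have "\<dots> = (\<Sum>i\<in>S. \<Sum>j\<in>T. (u i * v j) * D (indicator {i}) (indicator {j}))"
    by (simp add: sum_distrib_left mult.assoc)
  also have "\<bar>\<dots>\<bar> \<le> (\<Sum>i\<in>S. \<Sum>j\<in>T. \<bar>(u i * v j) * D (indicator {i}) (indicator {j})\<bar>)"
    by (intro order_trans[OF sum_abs] sum_mono) simp
  also have "\<dots> \<le> (\<Sum>i\<in>S. \<Sum>j\<in>T. 1 * \<bar>D (indicator {i}) (indicator {j})\<bar>)"
    unfolding abs_mult
    by (intro sum_mono mult_right_mono mult_le_one u v) auto
  finally show ?thesis by simp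
qed

section \<open>Norm clustering of a sequence of counterexamples\<close>

theorem corollary2p6:
  fixes p q :: real and I :: "'i set" and J :: "'j set"
  assumes "2 < p" and "2 < q" and "I \<noteq> {}" and "J \<noteq> {}"
  shows "Lpp_bilinear (lp_space p I) (lp_norm p I) (lp_space q J) (lp_norm q J)"
  unfolding Lpp_bilinear_def
proof (intro allI ballI impI, rule ccontr)
  fix e :: real and x :: "'i \<Rightarrow> real" and y :: "'j \<Rightarrow> real"
  let ?X = "lp_space p I" and ?Y = "lp_space q J" and ?NX = "lp_norm p I" and ?NY = "lp_norm q J"
  let ?norm = "bilinear_form_norm ?X ?NX ?Y ?NY"
  let ?bounded = "bounded_bilinear_form_on ?X ?NX ?Y ?NY"
  assume e: "0 < e" and x: "x \<in> ?X" "?NX x = 1" and y: "y \<in> ?Y" "?NY y = 1"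
    and no_eta: "\<not> (\<exists>\<eta>>0. \<forall>B. ?bounded B \<longrightarrow> ?norm B = 1 \<longrightarrow> B x y > 1 - \<eta> \<longrightarrow>
      (\<exists>G. ?bounded G \<and> ?norm G = 1 \<and> G x y = 1 \<and> ?norm (\<lambda>u v. B u v - G u v) < e))"
  have p: "0 < p" "2 \<le> p" and q: "0 < q" "2 \<le> q" using assms by auto
  \<comment> \<open>The thresholds \<open>1 / real (Suc n)\<close> produce counterexamples whose
    values at \<open>(x, y)\<close> tend to \<open>1\<close>.\<close>
  have "\<exists>B. ?bounded B \<and> ?norm B = 1 \<and> B x y > 1 - 1 / real (Suc n) \<and>
      (\<forall>G. ?bounded G \<longrightarrow> ?norm G = 1 \<longrightarrow> G x y = 1 \<longrightarrow> e \<le> ?norm (\<lambda>u v. B u v - G u v))" for n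
    using no_eta[unfolded not_ex, rule_format, of "1 / real (Suc n)"] by (auto simp: not_less)
  from choice[OF allI, OF this] obtain B where B': "\<forall>n. ?bounded (B n) \<and> ?norm (B n) = 1 \<and>
      B n x y > 1 - 1 / real (Suc n) \<and>
      (\<forall>G. ?bounded G \<longrightarrow> ?norm G = 1 \<longrightarrow> G x y = 1 \<longrightarrow> e \<le> ?norm (\<lambda>u v. B n u v - G u v))" ..
  then have B: "\<And>n. ?bounded (B n)" "\<And>n. ?norm (B n) = 1" "\<And>n. B n x y > 1 - 1 / real (Suc n)"
    by simp_all
  have far: "e \<le> ?norm (\<lambda>u v. B n u v - G u v)" if "?bounded G" "?norm G = 1" "G x y = 1" for n G
    using B' that by blast
  have bil: "bilinear_form_on ?X ?Y (B n)" for n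
    using B(1) by (simp add: bounded_bilinear_form_on_def)
  have bd: "\<bar>B n u v\<bar> \<le> ?NX u * ?NY v" if "u \<in> ?X" "v \<in> ?Y" for n u v
    using abs_bilinear_le_norm[OF B(1)[of n] _ _ _ _ _ _ that] p q B(2)[of n]
    by (simp add: lp_space_scaleR lp_norm_scaleR lp_norm_nonneg)
  obtain \<F> G where \<F>: "\<F> \<le> sequentially" "\<F> \<noteq> bot"
    and lim: "\<And>u v. u \<in> ?X \<Longrightarrow> v \<in> ?Y \<Longrightarrow> ((\<lambda>n. B n u v) \<longlongrightarrow> G u v) \<F>"
    using pointwise_cluster_filter[of ?X ?Y B "\<lambda>u v. ?NX u * ?NY v"] bd by blast
  \<comment> \<open>Identities satisfied by every \<open>B n\<close> pass to \<open>G\<close> by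
    uniqueness of limits along the nontrivial filter.\<close>
  have lim_eq: "a = b" if "(f \<longlongrightarrow> a) \<F>" "(g \<longlongrightarrow> b) \<F>" "\<And>n. f n = g n" for f g :: "nat \<Rightarrow> real" and a b
    using tendsto_unique[OF \<F>(2) that(1)] that(2) ext[of f g, OF that(3)] by blast
  have Gbil: "bilinear_form_on ?X ?Y G"
    unfolding bilinear_form_on_def
  proof (intro conjI ballI allI)
    fix u u' v v' c
    assume u: "u \<in> ?X" and v: "v \<in> ?Y"
    show "G (c *\<^sub>R u) v = c * G u v"
      by (rule lim_eq[OF lim tendsto_mult_left[OF lim]])
        (use bil u v in \<open>auto simp: bilinear_form_on_def lp_space_scaleR\<close>)
    show "G u (c *\<^sub>R v) = c * G u v"
      by (rule lim_eq[OF lim tendsto_mult_left[OF lim]])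
        (use bil u v in \<open>auto simp: bilinear_form_on_def lp_space_scaleR\<close>)
    show "G (u + u') v = G u v + G u' v" if "u' \<in> ?X"
      by (rule lim_eq[OF lim tendsto_add[OF lim lim]])
        (use bil u v that p in \<open>auto simp: bilinear_form_on_def lp_space_add\<close>)
    show "G u (v + v') = G u v + G u v'" if "v' \<in> ?Y"
      by (rule lim_eq[OF lim tendsto_add[OF lim lim]])
        (use bil u v that q in \<open>auto simp: bilinear_form_on_def lp_space_add\<close>)
  qed
  have Gbd: "\<bar>G u v\<bar> \<le> ?NX u * ?NY v" if "u \<in> ?X" "v \<in> ?Y" for u v
    using tendsto_upperbound[OF tendsto_rabs[OF lim[OF that]] always_eventually \<F>(2)] bd that by blast
  have Bxy_le: "B n x y \<le> 1" for n using bd[of x y n] x y by simp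
  have "(\<lambda>n. B n x y) \<longlonglongrightarrow> 1"
  proof (rule tendsto_sandwich)
    show "(\<lambda>n. 1 - 1 / real (Suc n)) \<longlonglongrightarrow> 1"
      using tendsto_diff[OF tendsto_const LIMSEQ_inverse_real_of_nat, of 1]
      by (simp add: inverse_eq_divide)
    show "\<forall>\<^sub>F n in sequentially. 1 - 1 / real (Suc n) \<le> B n x y"
      using B(3) by (intro always_eventually allI less_imp_le)
    show "\<forall>\<^sub>F n in sequentially. B n x y \<le> 1"
      using Bxy_le by simp
  qed simp
  then have Gxy: "G x y = 1"
    using tendsto_unique[OF \<F>(2) lim[OF x(1) y(1)]] tendsto_mono[OF \<F>(1)] by blast
  have zero: "0 \<in> ?X" "?NX 0 \<le> 1" "0 \<in> ?Y" "?NY 0 \<le> 1"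
    by (simp_all add: lp_space_def lp_norm_def)
  have le1: "\<bar>H u v\<bar> \<le> 1" if "\<And>u v. u \<in> ?X \<Longrightarrow> v \<in> ?Y \<Longrightarrow> \<bar>H u v\<bar> \<le> ?NX u * ?NY v"
    "u \<in> ?X" "v \<in> ?Y" "?NX u \<le> 1" "?NY v \<le> 1" for H :: "('i \<Rightarrow> real) \<Rightarrow> ('j \<Rightarrow> real) \<Rightarrow> real" and u v
    using that(1)[OF that(2,3)] mult_le_one[of "?NX u" "?NY v"] that(4,5) lp_norm_nonneg
    by (meson order_trans)
  have "?norm G \<le> 1"
    using zero le1[of G] Gbd by (intro bilinear_form_norm_le) auto
  moreover have "\<bar>G x y\<bar> \<le> ?norm G"
    using le1[of G] Gbd x y by (intro bilinear_form_norm_upper) auto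
  ultimately have Gnorm: "?norm G = 1" using Gxy by simp
  have Gbounded: "?bounded G"
    using Gbil Gbd unfolding bounded_bilinear_form_on_def by (auto intro: exI[of _ 1])
  \<comment> \<open>The final estimate has five contributions of size \<open>d\<close>: one from the
    block, and two tails for each of \<open>B n\<close> and \<open>G\<close>. Division by 6 makes
    the total smaller than \<open>e\<close>.\<close>
  define d where "d = e / 6"
  have d: "0 < d" using e by (simp add: d_def)
  obtain S \<eta> where S: "finite S" "S \<subseteq> I" "0 < \<eta>" and Stail: "\<And>H u v. bilinear_form_on ?X ?Y H \<Longrightarrow>
      (\<And>u v. u \<in> ?X \<Longrightarrow> v \<in> ?Y \<Longrightarrow> \<bar>H u v\<bar> \<le> ?NX u * ?NY v) \<Longrightarrow> 1 - \<eta> < H x y \<Longrightarrow>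
      u \<in> ?X \<Longrightarrow> ?NX u \<le> 1 \<Longrightarrow> (\<And>i. i \<in> S \<Longrightarrow> u i = 0) \<Longrightarrow> v \<in> ?Y \<Longrightarrow> ?NY v \<le> 1 \<Longrightarrow> \<bar>H u v\<bar> \<le> d"
    using bilinear_tail_small[OF assms(1) q(2) d, of x I y J] x y by fastforce
  \<comment> \<open>The tail lemma with the two spaces interchanged; now \<open>q > 2\<close>
    supplies the strict inequality.\<close>
  obtain T \<zeta> where T: "finite T" "T \<subseteq> J" "0 < \<zeta>" and Ttail': "\<And>H v u. bilinear_form_on ?Y ?X H \<Longrightarrow>
      (\<And>v u. v \<in> ?Y \<Longrightarrow> u \<in> ?X \<Longrightarrow> \<bar>H v u\<bar> \<le> ?NY v * ?NX u) \<Longrightarrow> 1 - \<zeta> < H y x \<Longrightarrow>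
      v \<in> ?Y \<Longrightarrow> ?NY v \<le> 1 \<Longrightarrow> (\<And>j. j \<in> T \<Longrightarrow> v j = 0) \<Longrightarrow> u \<in> ?X \<Longrightarrow> ?NX u \<le> 1 \<Longrightarrow> \<bar>H v u\<bar> \<le> d"
    using bilinear_tail_small[OF assms(2) p(2) d, of y J x I] x y by fastforce
  have Ttail: "\<bar>H u v\<bar> \<le> d" if "bilinear_form_on ?X ?Y H"
      "\<And>u v. u \<in> ?X \<Longrightarrow> v \<in> ?Y \<Longrightarrow> \<bar>H u v\<bar> \<le> ?NX u * ?NY v" "1 - \<zeta> < H x y"
      "v \<in> ?Y" "?NY v \<le> 1" "\<And>j. j \<in> T \<Longrightarrow> v j = 0" "u \<in> ?X" "?NX u \<le> 1" for H u v
    using Ttail'[OF bilinear_form_on_swap[OF that(1)] _ that(3-8)] that(2) by (simp add: mult.commute)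
  have ind: "indicator {i} \<in> ?X" "indicator {j} \<in> ?Y" if "i \<in> S" "j \<in> T" for i j
    using that S T p q by (auto intro: lp_space_indicator_singleton)
  define D where "D n u v = B n u v - G u v" for n u v
  have Dbil: "bilinear_form_on ?X ?Y (D n)" for n
    using bil[of n] Gbil unfolding bilinear_form_on_def D_def by (simp add: algebra_simps)
  have "((\<lambda>n. \<Sum>i\<in>S. \<Sum>j\<in>T. \<bar>D n (indicator {i}) (indicator {j})\<bar>) \<longlongrightarrow> (\<Sum>i\<in>S. \<Sum>j\<in>T. 0)) \<F>"
    unfolding D_def by (intro tendsto_sum tendsto_rabs_zero LIM_zero lim ind)
  then have small: "\<forall>\<^sub>F n in \<F>. (\<Sum>i\<in>S. \<Sum>j\<in>T. \<bar>D n (indicator {i}) (indicator {j})\<bar>) < d"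
    using d by (auto dest: order_tendstoD(2))
  have "\<forall>\<^sub>F n in \<F>. max (1 - \<eta>) (1 - \<zeta>) < B n x y"
    using lim[OF x(1) y(1)] S T by (intro order_tendstoD(1)) (auto simp: Gxy)
  from eventually_happens'[OF \<F>(2) eventually_conj[OF small this]] obtain n
    where n: "(\<Sum>i\<in>S. \<Sum>j\<in>T. \<bar>D n (indicator {i}) (indicator {j})\<bar>) < d"
      "1 - \<eta> < B n x y" "1 - \<zeta> < B n x y" by auto
  have "\<bar>D n u v\<bar> \<le> 5 * d" if u: "u \<in> ?X" "?NX u \<le> 1" and v: "v \<in> ?Y" "?NY v \<le> 1" for u v
  proof -
    define u1 u2 where "u1 = (\<lambda>i. if i \<in> S then u i else 0)" and "u2 = (\<lambda>i. if i \<in> S then 0 else u i)"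
    define v1 v2 where "v1 = (\<lambda>j. if j \<in> T then v j else 0)" and "v2 = (\<lambda>j. if j \<in> T then 0 else v j)"
    have dom: "\<bar>u1 i\<bar> \<le> \<bar>u i\<bar>" "\<bar>u2 i\<bar> \<le> \<bar>u i\<bar>" "\<bar>v1 j\<bar> \<le> \<bar>v j\<bar>" "\<bar>v2 j\<bar> \<le> \<bar>v j\<bar>" for i j
      by (simp_all add: u1_def u2_def v1_def v2_def)
    have zeros: "\<And>i. i \<in> S \<Longrightarrow> u2 i = 0" "\<And>j. j \<in> T \<Longrightarrow> v2 j = 0"
      by (simp_all add: u2_def v2_def)
    have G1: "1 - \<eta> < G x y" "1 - \<zeta> < G x y" using Gxy S T by simp_all
    have uu: "u1 \<in> ?X" "u2 \<in> ?X" "?NX u1 \<le> 1" "?NX u2 \<le> 1"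
      using lp_dominated[OF p(1) u(1) dom(1)] lp_dominated[OF p(1) u(1) dom(2)] u(2) by simp_all
    have vv: "v1 \<in> ?Y" "v2 \<in> ?Y" "?NY v1 \<le> 1" "?NY v2 \<le> 1"
      using lp_dominated[OF q(1) v(1) dom(3)] lp_dominated[OF q(1) v(1) dom(4)] v(2) by simp_all
    \<comment> \<open>Three pieces suffice: a tail in one argument leaves the other free, so
      \<open>u2\<close> is paired with the whole of \<open>v\<close>.\<close>
    have "u = u1 + u2" "v = v1 + v2" by (auto simp: u1_def u2_def v1_def v2_def)
    then have "D n u v = D n u1 v1 + D n u1 v2 + D n u2 v"
      using Dbil[of n] uu vv v(1) unfolding bilinear_form_on_def by auto
    moreover have "\<bar>D n u1 v1\<bar> < d"
      unfolding u1_def v1_def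
      using abs_le_lp_norm[OF p(1) u(1)] abs_le_lp_norm[OF q(1) v(1)] u v S T
      by (intro le_less_trans[OF bilinear_block_le[OF p(1) q(1) S(1,2) T(1,2) Dbil] n(1)])
        (meson order_trans subsetD)+
    \<comment> \<open>The tail bounds need near-attainment at \<open>(x, y)\<close>, which
      \<open>B n\<close> and \<open>G\<close> have but their difference does not; hence they are
      applied to each form separately.\<close>
    moreover have "\<bar>B n u1 v2\<bar> \<le> d" "\<bar>G u1 v2\<bar> \<le> d"
      using Ttail[OF bil bd n(3) vv(2,4) zeros(2) uu(1,3)]
        Ttail[OF Gbil Gbd G1(2) vv(2,4) zeros(2) uu(1,3)] by simp_all
    moreover have "\<bar>B n u2 v\<bar> \<le> d" "\<bar>G u2 v\<bar> \<le> d"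
      using Stail[OF bil bd n(2) uu(2,4) zeros(1) v] Stail[OF Gbil Gbd G1(1) uu(2,4) zeros(1) v]
      by simp_all
    ultimately show ?thesis by (simp add: D_def)
  qed
  then have "?norm (D n) \<le> 5 * d" using zero by (intro bilinear_form_norm_le) auto
  moreover have "e \<le> ?norm (D n)"
    using far[OF Gbounded Gnorm Gxy, of n] by (simp add: D_def[abs_def])
  ultimately show False using e by (simp add: d_def)
qed

end
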